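(* Let $x,\nu$ be (real or complex) parameters. For all $k,N\in\mathbb{N}\cup\{0\}$, $$H_{k+N}^{(\nu)}(x)=\sum_{i=0}^{N}a_{i}(N,\nu)\sum_{l=\max\{0,k-i\}}^{k}\binom{k}{l}(i)_{k-l}\,(-\nu)^{k-l}\,x^{i+l-k}\,H_{l}^{(\nu)}(x).$$
   Context: The Hermite polynomials $H_k^{(\nu)}(x)$ of variance $\nu$ are defined by the generating function $$\sum_{k=0}^{\infty}\frac{H_{k}^{(\nu)}(x)}{k!}t^{k}=e^{xt-\frac{\nu t^{2}}{2}}.$$ $(i)_m=i(i-1)\cdots(i-m+1)$ is the falling factorial, with $(i)_0=1$. Zeroth powers are equal to $1$. The coefficients $a_i(N,\nu)$ ($N\in\mathbb{N}\cup\{0\}$, $0\le i\le N$) are defined recursively by: $a_N(N,\nu)=1$ for $N\ge 0$; $a_{N-1}(N,\nu)=0$ for $N\ge 1$; $a_0(N,\nu)=-\nu\,a_1(N-1,\nu)$ for $N\ge 2$; and $a_i(N,\nu)=-(i+1)\,\nu\,a_{i+1}(N-1,\nu)+a_{i-1}(N-1,\nu)$ for $1\le i\le N-2$. (They are the coefficients in $\left(\frac{d}{dt}\right)^N F=\left(\sum_{i=0}^N a_i(N,\nu)(x-\nu t)^i\right)F$ for $F=e^{xt-\nu t^2/2}$.) *)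

theory Defs
  imports "HOL-Complex_Analysis.Laurent_Convergence"
begin

text \<open>
  The generating function \<open>exp (x t - \<nu> t\<^sup>2 / 2)\<close> is taken as a formal power series in \<open>t\<close>.
  The composition is the intended one because the inner series has constant term 0.
  All parameters live in an arbitrary field of characteristic 0, in particular in
  \<^typ>\<open>real\<close> or \<^typ>\<open>complex\<close>.
\<close>

definition hermite_gf :: "'a :: field_char_0 \<Rightarrow> 'a \<Rightarrow> 'a fps" where
  "hermite_gf \<nu> x = fps_exp 1 oo (fps_const x * fps_X - fps_const (\<nu> / 2) * fps_X ^ 2)"

definition hermite :: "'a :: field_char_0 \<Rightarrow> nat \<Rightarrow> 'a \<Rightarrow> 'a" where
  "hermite \<nu> k x = fact k * fps_nth (hermite_gf \<nu> x) k"

lemma hermite_generating_function: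
  "Abs_fps (\<lambda>k. hermite \<nu> k x / fact k) = hermite_gf \<nu> x"
  by (simp add: fps_eq_iff hermite_def)

text \<open>Over the complex numbers the formal identity is the analytic one.\<close>

lemma hermite_generating_function_analytic:
  fixes x \<nu> :: complex
  shows "(\<lambda>t. exp (x * t - \<nu> * t ^ 2 / 2)) has_fps_expansion
           Abs_fps (\<lambda>k. hermite \<nu> k x / fact k)"
proof -
  have inner: "(\<lambda>t. x * t - (\<nu> / 2) * t ^ 2) has_fps_expansion
      (fps_const x * fps_X - fps_const (\<nu> / 2) * fps_X ^ 2)"
    by (intro fps_expansion_intros)
  have outer: "(exp :: complex \<Rightarrow> complex) has_fps_expansion fps_exp 1"
    using has_fps_expansion_exp[of "1 :: complex"] by simp
  have "(exp \<circ> (\<lambda>t. x * t - (\<nu> / 2) * t ^ 2)) has_fps_expansion hermite_gf \<nu> x"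
    unfolding hermite_gf_def
    by (rule has_fps_expansion_compose[OF outer inner]) (simp add: fps_mult_nth power2_eq_square)
  then show ?thesis
    by (simp add: hermite_generating_function o_def)
qed

definition falling_factorial :: "nat \<Rightarrow> nat \<Rightarrow> 'a :: comm_ring_1" where
  "falling_factorial i m = (\<Prod>j<m. of_nat i - of_nat j)"

text \<open>
  \<open>deriv_coeff \<nu> N i\<close> is \<open>a\<^sub>i(N, \<nu>)\<close> for \<open>i \<le> N\<close>; the value 0 for \<open>i > N\<close> is a convention
  that is never used.
\<close>

fun deriv_coeff :: "'a :: comm_ring_1 \<Rightarrow> nat \<Rightarrow> nat \<Rightarrow> 'a" where
  "deriv_coeff \<nu> N i =
     (if i > N then 0
      else if i = N then 1
      else if i = N - 1 then 0
      else if i = 0 then - \<nu> * deriv_coeff \<nu> (N - 1) 1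
      else - of_nat (i + 1) * \<nu> * deriv_coeff \<nu> (N - 1) (i + 1) + deriv_coeff \<nu> (N - 1) (i - 1))"

declare deriv_coeff.simps [simp del]

lemma deriv_coeff_top: "deriv_coeff \<nu> N N = 1"
  by (simp add: deriv_coeff.simps)

lemma deriv_coeff_subtop: "N \<ge> 1 \<Longrightarrow> deriv_coeff \<nu> N (N - 1) = 0"
  by (simp add: deriv_coeff.simps)

lemma deriv_coeff_zero: "N \<ge> 2 \<Longrightarrow> deriv_coeff \<nu> N 0 = - \<nu> * deriv_coeff \<nu> (N - 1) 1"
  by (simp add: deriv_coeff.simps[of \<nu> N 0])

lemma deriv_coeff_rec:
  assumes "1 \<le> i" "i + 2 \<le> N"
  shows "deriv_coeff \<nu> N i =
           - of_nat (i + 1) * \<nu> * deriv_coeff \<nu> (N - 1) (i + 1) + deriv_coeff \<nu> (N - 1) (i - 1)"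
  using assms by (subst deriv_coeff.simps) auto

end

theory Submission
  imports Defs
begin

text \<open>
  Write \<open>F = exp (x t - \<nu> t\<^sup>2 / 2)\<close> and \<open>p = x - \<nu> t\<close>. The chain rule gives \<open>F' = p F\<close>, and
  \<open>p' = - \<nu>\<close>, so each derivative of \<open>F\<close> is a polynomial in \<open>p\<close> times \<open>F\<close>: differentiating
  \<open>p\<^sup>i F\<close> yields \<open>- i \<nu> p\<^sup>i\<^sup>-\<^sup>1 F + p\<^sup>i\<^sup>+\<^sup>1 F\<close>. Collecting powers of \<open>p\<close> gives exactly the recursion
  of the coefficients \<open>a\<^sub>i(N, \<nu>)\<close>, which is the content of \<open>higher_deriv_hermite_gf\<close>.

  The identity is then a comparison of the coefficients of \<open>t\<^sup>k / k!\<close>. Differentiation shifts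
  exponential coefficients, so the left-hand side becomes \<open>H\<^sub>k\<^sub>+\<^sub>N\<close>. On the right-hand side each
  product \<open>p\<^sup>i F\<close> contributes a binomial convolution of the exponential coefficients of
  \<open>p\<^sup>i\<close>, namely \<open>(i)\<^sub>m (- \<nu>)\<^sup>m x\<^sup>i\<^sup>-\<^sup>m\<close>, with those of \<open>F\<close>, namely the \<open>H\<^sub>l\<close>.
\<close>

text \<open>
  All cases of the definition of \<open>a\<^sub>i(N, \<nu>)\<close> are instances of one recursion, provided that
  coefficients with index outside \<open>0..N\<close> are read as 0. In this form the coefficients can be
  compared with a derivative without treating the boundary indices separately.
\<close>

lemma deriv_coeff_Suc:
  "deriv_coeff \<nu> (Suc N) i =
     - of_nat (Suc i) * \<nu> * deriv_coeff \<nu> N (Suc i) + (if i = 0 then 0 else deriv_coeff \<nu> N (i - 1))"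
proof -
  have out: "deriv_coeff \<nu> M j = 0" if "j > M" for M j
    using that by (simp add: deriv_coeff.simps)
  consider "i > Suc N" | "i = Suc N" | "i = N" | "i < N" by linarith
  then show ?thesis
  proof cases
    case 1
    then have "N < i - 1" by linarith
    with 1 show ?thesis by (simp add: out)
  next
    case 2
    then show ?thesis by (simp add: out deriv_coeff_top)
  next
    case 3
    then show ?thesis
      using deriv_coeff_subtop[of "Suc N" \<nu>] deriv_coeff_subtop[of N \<nu>] by (auto simp: out)
  next
    case 4
    then show ?thesis
      using deriv_coeff_zero[of "Suc N" \<nu>] deriv_coeff_rec[of i "Suc N" \<nu>] by (cases "i = 0") auto
  qed
qed

lemma fps_deriv_hermite_gf:
  "fps_deriv (hermite_gf \<nu> x) = (fps_const x - fps_const \<nu> * fps_X) * hermite_gf \<nu> x"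
proof -
  let ?b = "fps_const x * fps_X - fps_const (\<nu> / 2) * fps_X ^ 2"
  have "?b $ 0 = 0" by (simp add: fps_mult_nth power2_eq_square)
  then have "fps_deriv (hermite_gf \<nu> x) = (fps_deriv (fps_exp 1) oo ?b) * fps_deriv ?b"
    unfolding hermite_gf_def by (rule fps_compose_deriv)
  also have "fps_deriv ?b = fps_const x - fps_const (\<nu> / 2) * fps_const 2 * fps_X"
    by (simp add: power2_eq_square algebra_simps flip: numeral_fps_const)
  also have "fps_const (\<nu> / 2) * fps_const 2 = fps_const \<nu>"
    by (simp add: fps_const_mult)
  finally show ?thesis
    by (simp add: hermite_gf_def mult.commute)
qed

text \<open>
  Differentiating \<open>a\<^sub>i p\<^sup>i F\<close> by the product rule moves its coefficient up to \<open>p\<^sup>i\<^sup>+\<^sup>1\<close>, from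
  \<open>F' = p F\<close>, and down to \<open>p\<^sup>i\<^sup>-\<^sup>1\<close> with factor \<open>- i \<nu>\<close>, from \<open>p' = - \<nu>\<close>. Reindexing both sums
  by the resulting power of \<open>p\<close> produces the two terms of the recursion.
\<close>

lemma higher_deriv_hermite_gf:
  "(fps_deriv ^^ N) (hermite_gf \<nu> x) =
     (\<Sum>i\<le>N. fps_const (deriv_coeff \<nu> N i) * (fps_const x - fps_const \<nu> * fps_X) ^ i) * hermite_gf \<nu> x"
proof (induction N)
  case 0
  then show ?case by (simp add: deriv_coeff_top)
next
  case (Suc N)
  define p where "p = fps_const x - fps_const \<nu> * fps_X"
  define F where "F = hermite_gf \<nu> x"
  define a where "a = deriv_coeff \<nu> N"
  have a0: "a i = 0" if "i > N" for i
    using that by (simp add: a_def deriv_coeff.simps)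
  have dF: "fps_deriv F = p * F"
    by (simp add: F_def p_def fps_deriv_hermite_gf)
  have dp: "fps_deriv p = - fps_const \<nu>"
    by (simp add: p_def)
  have dpow: "fps_deriv (p ^ i) = - (fps_const (of_nat i * \<nu>) * p ^ (i - 1))" for i
    by (simp add: fps_deriv_power' dp fps_of_nat algebra_simps flip: fps_const_mult fps_const_neg)
  (* The two added terms vanish; the lost term i = 0 of the shift vanishes by its factor i. *)
  have "(\<Sum>i\<le>N. fps_const (of_nat i * \<nu> * a i) * p ^ (i - 1)) =
        (\<Sum>i\<le>Suc (Suc N). fps_const (of_nat i * \<nu> * a i) * p ^ (i - 1))"
    by (simp add: a0)
  also have "\<dots> = (\<Sum>i\<le>Suc N. fps_const (of_nat (Suc i) * \<nu> * a (Suc i)) * p ^ i)"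
    by (subst sum.atMost_Suc_shift) simp
  finally have down: "(\<Sum>i\<le>N. fps_const (of_nat i * \<nu> * a i) * p ^ (i - 1)) =
      (\<Sum>i\<le>Suc N. fps_const (of_nat (Suc i) * \<nu> * a (Suc i)) * p ^ i)" .
  have up: "(\<Sum>i\<le>N. fps_const (a i) * p ^ Suc i) =
      (\<Sum>i\<le>Suc N. fps_const (if i = 0 then 0 else a (i - 1)) * p ^ i)"
    by (subst sum.atMost_Suc_shift) simp
  have "(fps_deriv ^^ Suc N) F = fps_deriv ((\<Sum>i\<le>N. fps_const (a i) * p ^ i) * F)"
    using Suc.IH by (simp add: F_def p_def a_def)
  also have "\<dots> = ((\<Sum>i\<le>N. fps_const (a i) * p ^ Suc i)
      - (\<Sum>i\<le>N. fps_const (of_nat i * \<nu> * a i) * p ^ (i - 1))) * F"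
    by (simp add: fps_deriv_sum dF dpow algebra_simps sum_distrib_left sum_negf sum_subtractf
        flip: fps_const_mult)
  also have "\<dots> = (\<Sum>i\<le>Suc N. fps_const (deriv_coeff \<nu> (Suc N) i) * p ^ i) * F"
    unfolding down up sum_subtractf[symmetric]
    by (intro arg_cong2[where f = "(*)"] sum.cong refl)
       (simp only: deriv_coeff_Suc a_def left_diff_distrib[symmetric] fps_const_sub, simp add: algebra_simps)
  finally show ?case by (simp only: F_def p_def)
qed

lemma fact_nth_higher_deriv:
  fixes f :: "'a :: field_char_0 fps"
  shows "fact k * (fps_deriv ^^ N) f $ k = fact (k + N) * f $ (k + N)"
proof (induction N arbitrary: k)
  case (Suc N)
  have "fact k * (fps_deriv ^^ Suc N) f $ k = fact (Suc k) * (fps_deriv ^^ N) f $ Suc k"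
    by (simp add: algebra_simps)
  also have "\<dots> = fact (Suc k + N) * f $ (Suc k + N)"
    by (rule Suc.IH)
  finally show ?case by simp
qed simp

lemma falling_factorial_eq_fact_binomial:
  "(falling_factorial i m :: 'a :: field_char_0) = fact m * of_nat (i choose m)"
  by (simp add: falling_factorial_def binomial_gbinomial gbinomial_prod_rev atLeast0LessThan)

lemma fact_nth_linear_power:
  fixes x \<nu> :: "'a :: field_char_0"
  shows "fact m * ((fps_const x - fps_const \<nu> * fps_X) ^ i) $ m =
           falling_factorial i m * (- \<nu>) ^ m * x ^ (i - m)"
proof -
  have "((fps_const x - fps_const \<nu> * fps_X) ^ i) =
      (fps_const (- \<nu>) * fps_X + fps_const x) ^ i"
    by (simp add: fps_const_neg[symmetric] del: fps_const_neg)
  also have "\<dots> = (\<Sum>j\<le>i. fps_const (of_nat (i choose j) * (- \<nu>) ^ j * x ^ (i - j)) * fps_X ^ j)"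
    unfolding binomial_ring
    by (intro sum.cong refl)
       (simp add: power_mult_distrib fps_const_power fps_of_nat mult_ac flip: fps_const_mult)
  finally have eq: "((fps_const x - fps_const \<nu> * fps_X) ^ i) $ m =
      (\<Sum>j\<le>i. if m = j then of_nat (i choose j) * (- \<nu>) ^ j * x ^ (i - j) else 0)"
    by (simp add: fps_sum_nth fps_X_power_nth if_distrib cong: if_cong)
  show ?thesis
    unfolding eq by (simp add: falling_factorial_eq_fact_binomial mult_ac)
qed

text \<open>
  The product of two formal power series is the binomial convolution of their exponential
  coefficients. Here the sum may start at \<open>k - i\<close>, because a polynomial of degree at most \<open>i\<close>
  has no coefficient of index \<open>k - l\<close> for \<open>l < k - i\<close>.
\<close>

lemma fact_nth_linear_power_mult_hermite_gf:
  "fact k * ((fps_const x - fps_const \<nu> * fps_X) ^ i * hermite_gf \<nu> x) $ k =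
     (\<Sum>l=k - i..k. of_nat (k choose l) * falling_factorial i (k - l) * (- \<nu>) ^ (k - l) *
         x ^ (i + l - k) * hermite \<nu> l x)"
proof -
  define p where "p = fps_const x - fps_const \<nu> * fps_X"
  define F where "F = hermite_gf \<nu> x"
  have "fact k * (p ^ i * F) $ k = (\<Sum>l=0..k. fact k * (F $ l * (p ^ i) $ (k - l)))"
    by (simp add: mult.commute[of "p ^ i"] fps_mult_nth sum_distrib_left)
  also have "\<dots> = (\<Sum>l=0..k. of_nat (k choose l) * falling_factorial i (k - l) * (- \<nu>) ^ (k - l) *
         x ^ (i + l - k) * hermite \<nu> l x)"
  proof (intro sum.cong refl)
    fix l assume "l \<in> {0..k}"
    then have l: "l \<le> k" by simp
    then have e: "i - (k - l) = i + l - k" by simp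
    have "(fact k :: 'a) = of_nat (k choose l) * fact (k - l) * fact l"
      using binomial_fact_lemma[OF l, THEN arg_cong[where f = "of_nat :: nat \<Rightarrow> 'a"]]
      by (simp add: mult_ac)
    then have "fact k * (F $ l * (p ^ i) $ (k - l)) =
        of_nat (k choose l) * (fact (k - l) * (p ^ i) $ (k - l)) * (fact l * F $ l)"
      by (simp add: mult_ac)
    then show "fact k * (F $ l * (p ^ i) $ (k - l)) =
        of_nat (k choose l) * falling_factorial i (k - l) * (- \<nu>) ^ (k - l) *
         x ^ (i + l - k) * hermite \<nu> l x"
      unfolding p_def fact_nth_linear_power e by (simp add: F_def hermite_def mult_ac)
  qed
  also have "\<dots> = (\<Sum>l=k - i..k. of_nat (k choose l) * falling_factorial i (k - l) * (- \<nu>) ^ (k - l) *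
         x ^ (i + l - k) * hermite \<nu> l x)"
    by (intro sum.mono_neutral_right) (auto simp: falling_factorial_eq_fact_binomial)
  finally show ?thesis by (simp only: p_def F_def)
qed

theorem theorem2:
  fixes x \<nu> :: "'a :: field_char_0" and k N :: nat
  shows "hermite \<nu> (k + N) x =
    (\<Sum>i=0..N. deriv_coeff \<nu> N i *
      (\<Sum>l=max 0 (k - i)..k.
         of_nat (k choose l) * falling_factorial i (k - l) * (- \<nu>) ^ (k - l) *
         x ^ (i + l - k) * hermite \<nu> l x))"
proof -
  define p where "p = fps_const x - fps_const \<nu> * fps_X"
  define F where "F = hermite_gf \<nu> x"
  have "hermite \<nu> (k + N) x = fact k * (fps_deriv ^^ N) F $ k"
    by (simp add: hermite_def F_def fact_nth_higher_deriv)
  also have "(fps_deriv ^^ N) F = (\<Sum>i\<le>N. fps_const (deriv_coeff \<nu> N i) * (p ^ i * F))"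
    by (simp add: F_def p_def higher_deriv_hermite_gf sum_distrib_right mult.assoc)
  also have "fact k * \<dots> $ k = (\<Sum>i=0..N. deriv_coeff \<nu> N i * (fact k * (p ^ i * F) $ k))"
    by (simp add: fps_sum_nth sum_distrib_left mult.left_commute[of "fact k"] atMost_atLeast0)
  finally show ?thesis
    unfolding p_def F_def fact_nth_linear_power_mult_hermite_gf by simp
qed

end
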